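(* For any $\zeta\in\mathcal P_+(\mathcal Z)$, $\alpha_{\mathrm{gLSI}}(\zeta)\le 2\,\alpha_{\mathrm{gPI}}(\zeta)$.
   Context: $\mathcal Z$ is a finite set with $|\mathcal Z|\ge2$. $M\in\mathbb R^{|\mathcal Z|\times|\mathcal Z|}$ is a fixed irreducible generator (transition rate matrix: off-diagonal entries $\ge0$, rows sum to $0$), not necessarily reversible. $\mathcal P_+(\mathcal Z)$ is the set of strictly positive probability measures on $\mathcal Z$. $\mathbf 1$ is the constant function $1$ and $\langle\mathbf 1\rangle$ its span. For $\zeta\in\mathcal P_+(\mathcal Z)$: $\mathbb E_\zeta[f]=\sum_z f(z)\zeta(z)$; $\operatorname{var}_\zeta(f)=\mathbb E_\zeta[f^2]-(\mathbb E_\zeta[f])^2$; $\mathcal D_\zeta(\mathcal Z)=\{\varphi\in\mathbb R^{|\mathcal Z|}:\varphi(z)>0\ \forall z,\ \mathbb E_\zeta[\varphi]=1\}$; $\mathscr H_\zeta(\varphi)=\sum_z\varphi(z)\log\varphi(z)\,\zeta(z)$; $\mathscr E_\zeta(f)=\tfrac12\sum_{z,z'}M(z,z')\zeta(z)(f(z)-f(z'))^2$; $\mathscr R_\zeta(\varphi)=\sum_{z,z'}M(z,z')\zeta(z)\varphi(z)\bigl[\tfrac{\varphi(z')}{\varphi(z)}-1-\log\tfrac{\varphi(z')}{\varphi(z)}\bigr]$. The generalised Poincaré and log-Sobolev constants are $$\alpha_{\mathrm{gPI}}(\zeta)=\inf_{f\in\mathbb R^{|\mathcal Z|},\,f\notin\langle\mathbf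 1\rangle}\frac{\mathscr E_\zeta(f)}{\operatorname{var}_\zeta(f)},\qquad \alpha_{\mathrm{gLSI}}(\zeta)=\inf_{\varphi\in\mathcal D_\zeta(\mathcal Z),\,\varphi\ne\mathbf 1}\frac{\mathscr R_\zeta(\varphi)}{\mathscr H_\zeta(\varphi)}.$$ *)

theory Defs
  imports "HOL-Analysis.Analysis"
begin

(* The finite state space is the universe of a type 'z :: finite; functions, measures and
   matrices on it are elements of real ^ 'z and real ^ 'z ^ 'z, with M $ x $ y the rate from x to y. *)

definition generator :: "real ^ 'z ^ 'z \<Rightarrow> bool" where
  "generator M \<longleftrightarrow> (\<forall>x y. x \<noteq> y \<longrightarrow> 0 \<le> M $ x $ y) \<and> (\<forall>x. (\<Sum>y\<in>UNIV. M $ x $ y) = 0)"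

definition irreducible_generator :: "real ^ 'z ^ 'z \<Rightarrow> bool" where
  "irreducible_generator M \<longleftrightarrow>
     generator M \<and> (\<forall>x y. (x, y) \<in> {(u, v). u \<noteq> v \<and> 0 < M $ u $ v}\<^sup>*)"

definition pos_prob :: "(real ^ 'z) set" where
  "pos_prob = {\<zeta>. (\<forall>z. 0 < \<zeta> $ z) \<and> (\<Sum>z\<in>UNIV. \<zeta> $ z) = 1}"

definition expect :: "real ^ 'z \<Rightarrow> real ^ 'z \<Rightarrow> real" where
  "expect \<zeta> f = (\<Sum>z\<in>UNIV. f $ z * \<zeta> $ z)"

definition var :: "real ^ 'z \<Rightarrow> real ^ 'z \<Rightarrow> real" where
  "var \<zeta> f = expect \<zeta> (\<chi> z. (f $ z)\<^sup>2) - (expect \<zeta> f)\<^sup>2"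

definition densities :: "real ^ 'z \<Rightarrow> (real ^ 'z) set" where
  "densities \<zeta> = {\<phi>. (\<forall>z. 0 < \<phi> $ z) \<and> expect \<zeta> \<phi> = 1}"

definition rel_entropy :: "real ^ 'z \<Rightarrow> real ^ 'z \<Rightarrow> real" where
  "rel_entropy \<zeta> \<phi> = (\<Sum>z\<in>UNIV. \<phi> $ z * ln (\<phi> $ z) * \<zeta> $ z)"

definition dirichlet :: "real ^ 'z ^ 'z \<Rightarrow> real ^ 'z \<Rightarrow> real ^ 'z \<Rightarrow> real" where
  "dirichlet M \<zeta> f =
     (1 / 2) * (\<Sum>z\<in>UNIV. \<Sum>z'\<in>UNIV. M $ z $ z' * \<zeta> $ z * (f $ z - f $ z')\<^sup>2)"

definition fisher_info :: "real ^ 'z ^ 'z \<Rightarrow> real ^ 'z \<Rightarrow> real ^ 'z \<Rightarrow> real" where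
  "fisher_info M \<zeta> \<phi> =
     (\<Sum>z\<in>UNIV. \<Sum>z'\<in>UNIV. M $ z $ z' * \<zeta> $ z * \<phi> $ z *
        (\<phi> $ z' / \<phi> $ z - 1 - ln (\<phi> $ z' / \<phi> $ z)))"

(* In the following definitions 1 :: real ^ 'z is the constant function 1. For a generator M,
   a strictly positive \<zeta> and at least two states, both infima are over nonempty sets of
   nonnegative reals, with positive denominators, so the real-valued INF is the usual infimum. *)

definition gPI_const :: "real ^ 'z ^ 'z \<Rightarrow> real ^ 'z \<Rightarrow> real" where
  "gPI_const M \<zeta> = (INF f\<in>{f. f \<notin> span {1}}. dirichlet M \<zeta> f / var \<zeta> f)"

definition gLSI_const :: "real ^ 'z ^ 'z \<Rightarrow> real ^ 'z \<Rightarrow> real" where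
  "gLSI_const M \<zeta> = (INF \<phi>\<in>densities \<zeta> - {1}. fisher_info M \<zeta> \<phi> / rel_entropy \<zeta> \<phi>)"

end

theory Submission
  imports Defs "HOL-Real_Asymp.Real_Asymp"
begin

text \<open>Linearise at the constant density: for \<open>g = f - E f\<close> put \<open>\<phi> = 1 + \<epsilon> g\<close>. As \<open>\<epsilon> \<down> 0\<close>, the
  Fisher information of \<open>\<phi>\<close> is \<open>\<epsilon>\<^sup>2\<close> times the Dirichlet form of \<open>f\<close> up to \<open>o(\<epsilon>\<^sup>2)\<close>, and the relative
  entropy is \<open>\<epsilon>\<^sup>2 / 2\<close> times the variance of \<open>f\<close> up to \<open>o(\<epsilon>\<^sup>2)\<close>. Hence the log-Sobolev quotients of
  the densities \<open>\<phi>\<close> converge to twice the Poincare quotient of \<open>f\<close>.\<close>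

section \<open>Second-order expansions of the scalar integrands\<close>

lemma ln_one_plus_scaled_limit1:
  fixes a :: real
  shows "((\<lambda>e. ln (1 + e * a) / e) \<longlongrightarrow> a) (at_right 0)"
  by real_asymp

lemma ln_one_plus_scaled_limit2:
  fixes a :: real
  shows "((\<lambda>e. (ln (1 + e * a) - e * a) / e\<^sup>2) \<longlongrightarrow> - a\<^sup>2 / 2) (at_right 0)"
proof -
  \<comment> \<open>Fixing the sign of \<open>a\<close> gives \<open>real_asymp\<close> an expansion
    whose leading coefficient has a known sign.\<close>
  consider "a = 0" | "a > 0" | "a < 0" by linarith
  then show ?thesis
    by cases (simp, (real_asymp simp: power2_eq_square)+)
qed

text \<open>Split off \<open>e * a * ln (1 + e * a)\<close>: the remaining logarithmic term
  contributes \<open>- a\<^sup>2 / 2\<close>, the product contributes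
  \<open>a\<^sup>2\<close>.\<close>

lemma entropy_integrand_limit:
  fixes a :: real
  shows "((\<lambda>e. ((1 + e * a) * ln (1 + e * a) - e * a) / e\<^sup>2) \<longlongrightarrow> a\<^sup>2 / 2) (at_right 0)"
proof -
  have "((\<lambda>e. (ln (1 + e * a) - e * a) / e\<^sup>2 + a * (ln (1 + e * a) / e)) \<longlongrightarrow> - a\<^sup>2 / 2 + a * a)
      (at_right 0)"
    by (intro tendsto_intros ln_one_plus_scaled_limit1 ln_one_plus_scaled_limit2)
  moreover have "- a\<^sup>2 / 2 + a * a = a\<^sup>2 / 2"
    by (simp add: power2_eq_square)
  moreover have "\<forall>\<^sub>F e in at_right 0.
      (ln (1 + e * a) - e * a) / e\<^sup>2 + a * (ln (1 + e * a) / e) =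
      ((1 + e * a) * ln (1 + e * a) - e * a) / e\<^sup>2"
    using eventually_at_right_less
    by eventually_elim (simp add: field_simps power2_eq_square)
  ultimately show ?thesis
    by (simp only: tendsto_cong)
qed

lemma eventually_one_plus_scaled_pos:
  fixes a :: real
  shows "\<forall>\<^sub>F e in at_right 0. 0 < 1 + e * a"
proof -
  have "((\<lambda>e. 1 + e * a) \<longlongrightarrow> 1 + 0 * a) (at_right 0)"
    by (intro tendsto_intros)
  then show ?thesis
    by (intro order_tendstoD) auto
qed

text \<open>After multiplying out, the linear terms of the two logarithms cancel against
  \<open>e * (b - a)\<close>; what survives are their quadratic terms and the cross term
  \<open>e * a\<close> times the difference of the logarithms.\<close>

lemma fisher_integrand_limit:
  fixes a b :: real
  shows "((\<lambda>e. (1 + e * a) * ((1 + e * b) / (1 + e * a) - 1 - ln ((1 + e * b) / (1 + e * a))) / e\<^sup>2)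
    \<longlongrightarrow> (a - b)\<^sup>2 / 2) (at_right 0)"
proof -
  define L where "L = (\<lambda>c e::real. ln (1 + e * c))"
  have "((\<lambda>e. (L a e - e * a) / e\<^sup>2 - (L b e - e * b) / e\<^sup>2 - a * (L b e / e - L a e / e))
      \<longlongrightarrow> - a\<^sup>2 / 2 - (- b\<^sup>2 / 2) - a * (b - a)) (at_right 0)"
    unfolding L_def
    by (intro tendsto_intros ln_one_plus_scaled_limit1 ln_one_plus_scaled_limit2)
  moreover have "- a\<^sup>2 / 2 - (- b\<^sup>2 / 2) - a * (b - a) = (a - b)\<^sup>2 / 2"
    by (simp add: field_simps power2_eq_square)
  moreover have "\<forall>\<^sub>F e in at_right 0.
      (L a e - e * a) / e\<^sup>2 - (L b e - e * b) / e\<^sup>2 - a * (L b e / e - L a e / e) =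
      (1 + e * a) * ((1 + e * b) / (1 + e * a) - 1 - ln ((1 + e * b) / (1 + e * a))) / e\<^sup>2"
    using eventually_at_right_less eventually_one_plus_scaled_pos[of a]
      eventually_one_plus_scaled_pos[of b]
  proof eventually_elim
    case (elim e)
    have "ln ((1 + e * b) / (1 + e * a)) = L b e - L a e"
      using elim unfolding L_def by (simp add: ln_div)
    \<comment> \<open>Free variables stand for the logarithms here and below, so that both
      identities are purely algebraic.\<close>
    moreover have "(1 + e * a) * ((1 + e * b) / (1 + e * a) - 1 - x) =
        (1 + e * b) - (1 + e * a) - (1 + e * a) * x" for x
      using elim by (simp add: right_diff_distrib)
    moreover have "(u - e * a) / e\<^sup>2 - (v - e * b) / e\<^sup>2 - a * (v / e - u / e) =
        ((1 + e * b) - (1 + e * a) - (1 + e * a) * (v - u)) / e\<^sup>2" for u v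
      using elim(1) by (simp add: field_simps power2_eq_square)
    ultimately show ?case
      by simp
  qed
  ultimately show ?thesis
    by (simp only: tendsto_cong)
qed

section \<open>Small perturbations of the constant density\<close>

definition perturbation :: "real ^ 'z \<Rightarrow> real \<Rightarrow> real ^ 'z" where
  "perturbation g e = (\<chi> z. 1 + e * g $ z)"

lemma fisher_info_perturbation_limit:
  "((\<lambda>e. fisher_info M \<zeta> (perturbation g e) / e\<^sup>2) \<longlongrightarrow> dirichlet M \<zeta> g) (at_right 0)"
proof -
  have "((\<lambda>e. \<Sum>z\<in>UNIV. \<Sum>z'\<in>UNIV. M $ z $ z' * \<zeta> $ z *
      ((1 + e * g $ z) * ((1 + e * g $ z') / (1 + e * g $ z) - 1
        - ln ((1 + e * g $ z') / (1 + e * g $ z))) / e\<^sup>2)) \<longlongrightarrow>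
      (\<Sum>z\<in>UNIV. \<Sum>z'\<in>UNIV. M $ z $ z' * \<zeta> $ z * ((g $ z - g $ z')\<^sup>2 / 2))) (at_right 0)"
    by (intro tendsto_sum tendsto_mult tendsto_const fisher_integrand_limit)
  then show ?thesis
    by (simp add: fisher_info_def dirichlet_def perturbation_def sum_divide_distrib mult.assoc)
qed

text \<open>The added terms cancel because both masses are 1. The new integrand is nonnegative and
  vanishes to second order at 1, so limits and signs can be handled state by state.\<close>

lemma rel_entropy_eq:
  assumes "\<zeta> \<in> pos_prob" "expect \<zeta> \<phi> = 1"
  shows "rel_entropy \<zeta> \<phi> = (\<Sum>z\<in>UNIV. \<zeta> $ z * (\<phi> $ z * ln (\<phi> $ z) - \<phi> $ z + 1))"
proof -
  have "(\<Sum>z\<in>UNIV. \<zeta> $ z * (\<phi> $ z * ln (\<phi> $ z) - \<phi> $ z + 1)) =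
      rel_entropy \<zeta> \<phi> - expect \<zeta> \<phi> + (\<Sum>z\<in>UNIV. \<zeta> $ z)"
    by (simp add: rel_entropy_def expect_def algebra_simps sum.distrib sum_subtractf)
  then show ?thesis
    using assms by (simp add: pos_prob_def)
qed

lemma expect_perturbation:
  assumes "\<zeta> \<in> pos_prob" "expect \<zeta> g = 0"
  shows "expect \<zeta> (perturbation g e) = 1"
proof -
  have "expect \<zeta> (perturbation g e) = (\<Sum>z\<in>UNIV. \<zeta> $ z) + e * expect \<zeta> g"
    by (simp add: expect_def perturbation_def algebra_simps sum.distrib sum_distrib_left)
  then show ?thesis
    using assms by (simp add: pos_prob_def)
qed

lemma rel_entropy_perturbation_limit:
  assumes "\<zeta> \<in> pos_prob" "expect \<zeta> g = 0"
  shows "((\<lambda>e. rel_entropy \<zeta> (perturbation g e) / e\<^sup>2) \<longlongrightarrow> var \<zeta> g / 2) (at_right 0)"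
proof -
  have "((\<lambda>e. \<Sum>z\<in>UNIV. \<zeta> $ z * (((1 + e * g $ z) * ln (1 + e * g $ z) - e * g $ z) / e\<^sup>2)) \<longlongrightarrow>
      (\<Sum>z\<in>UNIV. \<zeta> $ z * ((g $ z)\<^sup>2 / 2))) (at_right 0)"
    by (intro tendsto_sum tendsto_mult tendsto_const entropy_integrand_limit)
  \<comment> \<open>The squared mean in \<open>var\<close> vanishes since \<open>g\<close> is
    centred.\<close>
  moreover have "(\<Sum>z\<in>UNIV. \<zeta> $ z * ((g $ z)\<^sup>2 / 2)) = var \<zeta> g / 2"
    using assms(2) by (simp add: var_def expect_def sum_divide_distrib mult.commute)
  moreover have "rel_entropy \<zeta> (perturbation g e) / e\<^sup>2 =
      (\<Sum>z\<in>UNIV. \<zeta> $ z * (((1 + e * g $ z) * ln (1 + e * g $ z) - e * g $ z) / e\<^sup>2))" for e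
    unfolding rel_entropy_eq[OF assms(1) expect_perturbation[OF assms]] sum_divide_distrib
    by (simp add: perturbation_def)
  ultimately show ?thesis
    by (simp only:)
qed

lemma eventually_perturbation_in_densities:
  assumes "\<zeta> \<in> pos_prob" "expect \<zeta> g = 0" "g \<noteq> 0"
  shows "\<forall>\<^sub>F e in at_right 0. perturbation g e \<in> densities \<zeta> - {1}"
proof -
  \<comment> \<open>Finiteness of the state space gives one threshold for \<open>e\<close> that
    serves all states.\<close>
  have "\<forall>\<^sub>F e in at_right 0. \<forall>z. 0 < 1 + e * g $ z"
    by (intro eventually_all_finite eventually_one_plus_scaled_pos)
  then show ?thesis
    using eventually_at_right_less
  proof eventually_elim
    case (elim e)
    obtain z where "g $ z \<noteq> 0"
      using assms(3) by (auto simp: vec_eq_iff)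
    then have "perturbation g e $ z \<noteq> 1 $ z"
      using elim by (simp add: perturbation_def)
    then have "perturbation g e \<noteq> 1"
      by metis
    then show ?case
      using elim expect_perturbation[OF assms(1,2)] by (simp add: densities_def perturbation_def)
  qed
qed

section \<open>Lower bounds that make the infimum meaningful\<close>

lemma fisher_info_nonneg:
  assumes "generator M" "\<zeta> \<in> pos_prob" "\<phi> \<in> densities \<zeta>"
  shows "0 \<le> fisher_info M \<zeta> \<phi>"
  unfolding fisher_info_def
proof (intro sum_nonneg)
  fix z z' :: 'a
  have pos: "0 < \<phi> $ z" "0 < \<phi> $ z'" "0 < \<zeta> $ z"
    using assms by (auto simp: densities_def pos_prob_def)
  show "0 \<le> M $ z $ z' * \<zeta> $ z * \<phi> $ z * (\<phi> $ z' / \<phi> $ z - 1 - ln (\<phi> $ z' / \<phi> $ z))"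
  proof (cases "z = z'")
    \<comment> \<open>A diagonal rate may be negative, but there the ratio is 1 and the bracket is
      zero.\<close>
    case True
    then show ?thesis using pos by simp
  next
    case False
    have "ln (\<phi> $ z' / \<phi> $ z) \<le> \<phi> $ z' / \<phi> $ z - 1"
      using pos by (intro ln_le_minus_one) simp
    then show ?thesis
      using False assms(1) pos by (intro mult_nonneg_nonneg) (auto simp: generator_def)
  qed
qed

lemma rel_entropy_nonneg:
  assumes "\<zeta> \<in> pos_prob" "\<phi> \<in> densities \<zeta>"
  shows "0 \<le> rel_entropy \<zeta> \<phi>"
proof -
  have "0 \<le> \<zeta> $ z * (\<phi> $ z * ln (\<phi> $ z) - \<phi> $ z + 1)" for z
  proof -
    have pos: "0 < \<phi> $ z" "0 < \<zeta> $ z"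
      using assms by (auto simp: densities_def pos_prob_def)
    \<comment> \<open>Applying \<open>ln x \<le> x - 1\<close> at the reciprocal bounds
      \<open>ln\<close> from below.\<close>
    have "\<phi> $ z * ln (1 / \<phi> $ z) \<le> \<phi> $ z * (1 / \<phi> $ z - 1)"
      using pos by (intro mult_left_mono ln_le_minus_one) auto
    then show ?thesis
      using pos by (simp add: ln_div right_diff_distrib)
  qed
  then show ?thesis
    using assms by (subst rel_entropy_eq) (auto simp: densities_def intro: sum_nonneg)
qed

lemma gLSI_const_le:
  assumes "generator M" "\<zeta> \<in> pos_prob" "\<phi> \<in> densities \<zeta> - {1}"
  shows "gLSI_const M \<zeta> \<le> fisher_info M \<zeta> \<phi> / rel_entropy \<zeta> \<phi>"
  unfolding gLSI_const_def
proof (rule cINF_lower[OF _ assms(3)])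
  show "bdd_below ((\<lambda>\<phi>. fisher_info M \<zeta> \<phi> / rel_entropy \<zeta> \<phi>) ` (densities \<zeta> - {1}))"
    \<comment> \<open>Weak nonnegativity of the denominator suffices: division by zero would yield
      0, which respects the bound.\<close>
    using fisher_info_nonneg[OF assms(1,2)] rel_entropy_nonneg[OF assms(2)]
    by (intro bdd_belowI2[where m = 0]) auto
qed

lemma gLSI_const_le_centred:
  assumes "generator M" "\<zeta> \<in> pos_prob" "expect \<zeta> g = 0" "g \<noteq> 0"
  shows "gLSI_const M \<zeta> \<le> 2 * (dirichlet M \<zeta> g / var \<zeta> g)"
proof -
  obtain z where "g $ z \<noteq> 0"
    using assms(4) by (auto simp: vec_eq_iff)
  \<comment> \<open>A nonzero centred function has positive variance, so the limit of the quotients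
    may be taken; the halved variance then yields the factor 2.\<close>
  then have "0 < (\<Sum>z\<in>UNIV. (g $ z)\<^sup>2 * \<zeta> $ z)"
    using assms(2) by (intro sum_pos2[of _ z]) (auto simp: pos_prob_def less_imp_le)
  then have "var \<zeta> g / 2 \<noteq> 0"
    using assms(3) by (simp add: var_def expect_def)
  from tendsto_divide[OF fisher_info_perturbation_limit
      rel_entropy_perturbation_limit[OF assms(2,3)] this]
  have lim: "((\<lambda>e. (fisher_info M \<zeta> (perturbation g e) / e\<^sup>2) / (rel_entropy \<zeta> (perturbation g e) / e\<^sup>2))
      \<longlongrightarrow> dirichlet M \<zeta> g / (var \<zeta> g / 2)) (at_right 0)" .
  have "\<forall>\<^sub>F e in at_right 0. gLSI_const M \<zeta> \<le>
      (fisher_info M \<zeta> (perturbation g e) / e\<^sup>2) / (rel_entropy \<zeta> (perturbation g e) / e\<^sup>2)"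
    using eventually_perturbation_in_densities[OF assms(2-4)] eventually_at_right_less
    by eventually_elim (use gLSI_const_le[OF assms(1,2)] in simp)
  then have "gLSI_const M \<zeta> \<le> dirichlet M \<zeta> g / (var \<zeta> g / 2)"
    by (intro tendsto_lowerbound[OF lim]) auto
  then show ?thesis
    by (simp add: mult.commute)
qed

section \<open>Reduction to centred functions\<close>

lemma expect_diff_const:
  assumes "\<zeta> \<in> pos_prob"
  shows "expect \<zeta> (\<chi> z. f $ z - c) = expect \<zeta> f - c"
  using assms
  by (simp add: expect_def pos_prob_def left_diff_distrib sum_subtractf flip: sum_distrib_left)

lemma var_diff_const:
  assumes "\<zeta> \<in> pos_prob"
  shows "var \<zeta> (\<chi> z. f $ z - c) = var \<zeta> f"
proof -
  have "expect \<zeta> (\<chi> z. (f $ z - c)\<^sup>2) =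
      expect \<zeta> (\<chi> z. (f $ z)\<^sup>2) - 2 * c * expect \<zeta> f + c\<^sup>2 * (\<Sum>z\<in>UNIV. \<zeta> $ z)"
    by (simp add: expect_def power2_diff algebra_simps sum.distrib sum_subtractf sum_distrib_left
        sum_distrib_right)
  then show ?thesis
    using assms
    by (simp add: var_def expect_diff_const power2_diff pos_prob_def algebra_simps power2_eq_square)
qed

text \<open>Subtracting the mean changes neither the variance nor the Dirichlet form, which sees
  only differences; the result is nonzero because \<open>f\<close> is not constant.\<close>

lemma gLSI_const_le_poincare_quotient:
  assumes "generator M" "\<zeta> \<in> pos_prob" "f \<notin> span {1}"
  shows "gLSI_const M \<zeta> \<le> 2 * (dirichlet M \<zeta> f / var \<zeta> f)"
proof -
  define g where "g = (\<chi> z. f $ z - expect \<zeta> f)"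
  have "g \<noteq> 0"
  proof
    assume "g = 0"
    then have "f = expect \<zeta> f *\<^sub>R 1"
      by (simp add: g_def vec_eq_iff)
    then show False
      using assms(3) by (metis span_base span_scale singletonI)
  qed
  moreover have "expect \<zeta> g = 0"
    using assms(2) by (simp add: g_def expect_diff_const)
  moreover have "dirichlet M \<zeta> g = dirichlet M \<zeta> f"
    by (simp add: dirichlet_def g_def)
  moreover have "var \<zeta> g = var \<zeta> f"
    using assms(2) by (simp add: g_def var_diff_const)
  ultimately show ?thesis
    using gLSI_const_le_centred[OF assms(1,2)] by metis
qed

lemma exists_nonconstant:
  assumes "CARD('z::finite) \<ge> 2"
  shows "\<exists>f :: real ^ 'z. f \<notin> span {1}"
proof -
  obtain x y :: 'z where "x \<noteq> y"
    using assms by (metis One_nat_def card_le_Suc0_iff_eq finite_class.finite_UNIV not_less_eq_eq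
        numeral_2_eq_2)
  \<comment> \<open>The indicator of \<open>x\<close> separates \<open>x\<close> from
    \<open>y\<close>.\<close>
  then have "axis x (1::real) \<noteq> k *\<^sub>R 1" for k
    by (auto simp: vec_eq_iff axis_def) (metis zero_neq_one)
  then show ?thesis
    by (auto simp: span_singleton)
qed

theorem proposition4p1:
  fixes M :: "real ^ 'z ^ 'z" and \<zeta> :: "real ^ 'z"
  assumes "CARD('z) \<ge> 2"
    and "irreducible_generator M"
    and "\<zeta> \<in> pos_prob"
  shows "gLSI_const M \<zeta> \<le> 2 * gPI_const M \<zeta>"
proof -
  \<comment> \<open>Halving turns the claim into a lower bound on every quotient under the
    infimum.\<close>
  have "gLSI_const M \<zeta> / 2 \<le> gPI_const M \<zeta>"
    unfolding gPI_const_def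
  proof (rule cINF_greatest)
    show "{f :: real ^ 'z. f \<notin> span {1}} \<noteq> {}"
      using exists_nonconstant[OF assms(1)] by simp
  next
    fix f :: "real ^ 'z"
    assume "f \<in> {f. f \<notin> span {1}}"
    then show "gLSI_const M \<zeta> / 2 \<le> dirichlet M \<zeta> f / var \<zeta> f"
      using gLSI_const_le_poincare_quotient[of M \<zeta> f] assms
      by (simp add: irreducible_generator_def mult.commute)
  qed
  then show ?thesis
    by simp
qed

end
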